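(* Let $r \ge 3$, $n \ge 1$, and let $S \subseteq [r]^n$ be a set that does not contain a combinatorial line; write $\mu(S) = |S|/r^n$. Then there exists an $r$-prover game $\mathcal{G}_S$ with question set $\overline{Q}_r$ and with answer alphabets $A^{(j)} = 2^{[n]} \times [n]$ for every $j \in [r]$ such that: (i) $\mathrm{val}(\mathcal{G}_S) \le 1 - 1/r$; (ii) $\mathrm{val}(\mathcal{G}_S^n) \ge \mu(S)$.
   Context: Notation: $[r] = \{1,\dots,r\}$, and $2^{[n]}$ denotes the power set of $[n]$. Combinatorial lines: a combinatorial pattern over $[r]^n$ is a string $\underline{b} = (b_1,\dots,b_n) \in ([r]\cup\{\star\})^n \setminus [r]^n$, where $\star$ is a wildcard symbol; thus a pattern contains at least one $\star$. For $q \in [r]$, the string $\underline{b}(q) \in [r]^n$ is obtained from $\underline{b}$ by replacing every $\star$ by $q$. The combinatorial line of $\underline{b}$ is $L(\underline{b}) = \{\underline{b}(1),\dots,\underline{b}(r)\}$. A set $S \subseteq [r]^n$ contains a combinatorial line if $L(\underline{b}) \subseteq S$ for some pattern $\underline{b}$. Games: an $r$-prover question set is a finite nonempty set $\overline{Q} \subseteq Q^{(1)}\times\cdots\times Q^{(r)}$, where $Q^{(1)},\dots,Q^{(r)}$ are finite sets and every element of each $Q^{(j)}$ occurs as the $j$-th coordinate of some tuple of $\overline{Q}$. An $r$-prover game with question set $\overline{Q}$ is a triple $(\overline{Q},\overline{A},V)$, where $\overline{A} = A^{(1)}\times\cdots\times A^{(r)}$ is a product of finite answer alphabets and $V:\overline{Q}\times\overline{A}\to\{0,1\}$.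 A strategy is a tuple $(\mathcal{S}^{(1)},\dots,\mathcal{S}^{(r)})$ of functions $\mathcal{S}^{(j)}: Q^{(j)}\to A^{(j)}$. The value $\mathrm{val}(\mathcal{G})$ is the maximum over strategies of $\Pr[V(\overline{q}, \mathcal{S}^{(1)}(q^{(1)}),\dots,\mathcal{S}^{(r)}(q^{(r)}))=1]$, where $\overline{q}=(q^{(1)},\dots,q^{(r)})$ is uniform on $\overline{Q}$. The $n$-fold parallel repetition $\mathcal{G}^n$ is the $r$-prover game with question set $\overline{Q}^n$ (prover $j$ receives the vector of the $j$-th coordinates of the $n$ independent question tuples, i.e. an element of $(Q^{(j)})^n$), answer alphabets $(A^{(j)})^n$, and predicate that accepts iff $V$ accepts in each of the $n$ coordinates. The question set $\overline{Q}_r$: for $r\ge 2$, $Q^{(j)}=\{0,1\}$ for all $j$, and $\overline{Q}_r = \{(q^{(1)},\dots,q^{(r)})\in\{0,1\}^r : |\{j : q^{(j)}=1\}| = 1\}$. *)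

theory Defs
  imports "HOL-Probability.Probability_Mass_Function"
begin

section \<open>Combinatorial lines\<close>

definition words :: "nat \<Rightarrow> nat \<Rightarrow> (nat \<Rightarrow> nat) set" where
  "words r n = {1..n} \<rightarrow>\<^sub>E {1..r}"

text \<open>In a pattern, \<^term>\<open>None\<close> is the wildcard symbol.\<close>

definition patterns :: "nat \<Rightarrow> nat \<Rightarrow> (nat \<Rightarrow> nat option) set" where
  "patterns r n =
    ({1..n} \<rightarrow>\<^sub>E insert None (Some ` {1..r})) - ({1..n} \<rightarrow>\<^sub>E Some ` {1..r})"

definition fill_pattern :: "nat \<Rightarrow> (nat \<Rightarrow> nat option) \<Rightarrow> nat \<Rightarrow> (nat \<Rightarrow> nat)" where
  "fill_pattern n b q = (\<lambda>i\<in>{1..n}. case b i of None \<Rightarrow> q | Some x \<Rightarrow> x)"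

definition combinatorial_line :: "nat \<Rightarrow> nat \<Rightarrow> (nat \<Rightarrow> nat option) \<Rightarrow> (nat \<Rightarrow> nat) set" where
  "combinatorial_line r n b = fill_pattern n b ` {1..r}"

definition contains_combinatorial_line :: "nat \<Rightarrow> nat \<Rightarrow> (nat \<Rightarrow> nat) set \<Rightarrow> bool" where
  "contains_combinatorial_line r n S \<longleftrightarrow> (\<exists>b\<in>patterns r n. combinatorial_line r n b \<subseteq> S)"

definition word_density :: "nat \<Rightarrow> nat \<Rightarrow> (nat \<Rightarrow> nat) set \<Rightarrow> real" where
  "word_density r n S = real (card S) / real (r ^ n)"


section \<open>Multi-prover games\<close>

text \<open>
  Provers are numbered \<open>1, \<dots>, r\<close>; tuples indexed by the provers (question tuples, answer
  tuples, strategies) and vectors indexed by the repetitions are functions that are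
  \<^const>\<open>undefined\<close> outside \<open>{1..r}\<close> and \<open>{1..n}\<close>, respectively.
  Only the values of \<open>answer_set\<close> on \<open>{1..r}\<close>, and those of \<open>accepts\<close> on question tuples of the
  game and answer tuples over its alphabets, are relevant.
\<close>

record ('q, 'a) game =
  question_tuples :: "(nat \<Rightarrow> 'q) set"
  answer_set :: "nat \<Rightarrow> 'a set"
  accepts :: "(nat \<Rightarrow> 'q) \<Rightarrow> (nat \<Rightarrow> 'a) \<Rightarrow> bool"

text \<open>
  Every element of the question alphabet of prover \<open>j\<close> is required to occur as the \<open>j\<close>-th
  coordinate of some question tuple, so the alphabet is determined by the set of question tuples.
\<close>

definition questions :: "('q, 'a) game \<Rightarrow> nat \<Rightarrow> 'q set" where
  "questions G j = (\<lambda>q. q j) ` question_tuples G"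

text \<open>Nonempty answer alphabets are needed for the maximum defining the value to exist.\<close>

definition prover_game :: "nat \<Rightarrow> ('q, 'a) game \<Rightarrow> bool" where
  "prover_game r G \<longleftrightarrow>
    finite (question_tuples G) \<and> question_tuples G \<noteq> {} \<and>
    question_tuples G \<subseteq> extensional {1..r} \<and>
    (\<forall>j\<in>{1..r}. finite (answer_set G j) \<and> answer_set G j \<noteq> {})"

definition strategies :: "nat \<Rightarrow> ('q, 'a) game \<Rightarrow> (nat \<Rightarrow> 'q \<Rightarrow> 'a) set" where
  "strategies r G = (\<Pi>\<^sub>E j\<in>{1..r}. questions G j \<rightarrow>\<^sub>E answer_set G j)"

definition winning_prob :: "nat \<Rightarrow> ('q, 'a) game \<Rightarrow> (nat \<Rightarrow> 'q \<Rightarrow> 'a) \<Rightarrow> real" where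
  "winning_prob r G \<sigma> =
    measure_pmf.prob (pmf_of_set (question_tuples G))
      {q. accepts G q (\<lambda>j\<in>{1..r}. \<sigma> j (q j))}"

definition game_value :: "nat \<Rightarrow> ('q, 'a) game \<Rightarrow> real" where
  "game_value r G = Max (winning_prob r G ` strategies r G)"

text \<open>
  An element of the \<open>n\<close>-th power of the set of question tuples is stored transposed: it sends
  a prover \<open>j\<close> to the vector of the \<open>j\<close>-th coordinates of the \<open>n\<close> question tuples.
\<close>

definition parallel_repetition ::
    "nat \<Rightarrow> ('q, 'a) game \<Rightarrow> nat \<Rightarrow> (nat \<Rightarrow> 'q, nat \<Rightarrow> 'a) game" where
  "parallel_repetition r G n =
    \<lparr> question_tuples =
        (\<lambda>qs. \<lambda>j\<in>{1..r}. \<lambda>i\<in>{1..n}. qs i j) ` ({1..n} \<rightarrow>\<^sub>E question_tuples G),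
      answer_set = (\<lambda>j. {1..n} \<rightarrow>\<^sub>E answer_set G j),
      accepts = (\<lambda>x a. \<forall>i\<in>{1..n}. accepts G (\<lambda>j\<in>{1..r}. x j i) (\<lambda>j\<in>{1..r}. a j i)) \<rparr>"

definition Qbar :: "nat \<Rightarrow> (nat \<Rightarrow> nat) set" where
  "Qbar r = {q \<in> {1..r} \<rightarrow>\<^sub>E {0, 1}. card {j \<in> {1..r}. q j = 1} = 1}"

end

theory Submission
  imports Defs
begin

text \<open>
  A question tuple of \<^term>\<open>Qbar r\<close> singles out one prover, so the tuples of the \<open>n\<close>-fold
  repetition are words \<open>w\<close> over \<open>[r]\<close>, and prover \<open>j\<close> sees exactly the set of positions where
  \<open>w\<close> has the letter \<open>j\<close>. The verifier asks the provers to announce a word of \<open>S\<close>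
  (each prover giving the positions of its own letter) together with a common position at
  which the word has the letter of the singled-out prover. In the repetition the provers can announce
  \<open>w\<close> itself whenever \<open>w \<in> S\<close>. In the single game, a strategy winning on all \<open>r\<close> questions
  makes the provers announce words \<open>w\<^sub>1, \<dots>, w\<^sub>r\<close> of \<open>S\<close> which only differ at positions where
  \<open>w\<^sub>j\<close> has the letter \<open>j\<close> for every \<open>j\<close>, and the announced position is one of these: they form a
  combinatorial line.
\<close>

section \<open>Question tuples that single out one prover\<close>

definition singled_out :: "nat \<Rightarrow> nat \<Rightarrow> nat \<Rightarrow> nat" where
  "singled_out r j = (\<lambda>k\<in>{1..r}. if k = j then 1 else 0)"

lemma Qbar_eq: "Qbar r = singled_out r ` {1..r}"
proof (intro equalityI subsetI)
  fix q assume "q \<in> Qbar r"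
  then have q: "q \<in> {1..r} \<rightarrow>\<^sub>E {0, 1}" and "card {j \<in> {1..r}. q j = 1} = 1"
    by (auto simp: Qbar_def)
  then obtain j where j: "{j \<in> {1..r}. q j = 1} = {j}"
    by (auto simp: card_1_singleton_iff)
  then have "j \<in> {1..r}" by blast
  moreover have "q = singled_out r j"
  proof
    fix k
    show "q k = singled_out r j k"
    proof (cases "k \<in> {1..r}")
      case True
      have "q k \<in> {0, 1}"
        using PiE_mem[OF q True] .
      moreover have "k \<in> {k \<in> {1..r}. q k = 1} \<longleftrightarrow> k = j"
        unfolding j by simp
      ultimately show ?thesis using True by (auto simp: singled_out_def)
    next
      case False
      then show ?thesis
        using PiE_arb[OF q False] by (auto simp: singled_out_def)
    qed
  qed
  ultimately show "q \<in> singled_out r ` {1..r}" by blast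
next
  fix q assume "q \<in> singled_out r ` {1..r}"
  then obtain j where j: "j \<in> {1..r}" and q: "q = singled_out r j" by blast
  have "{k \<in> {1..r}. q k = 1} = {j}"
    using j by (auto simp: q singled_out_def split: if_splits)
  then show "q \<in> Qbar r"
    by (auto simp: Qbar_def q singled_out_def)
qed

lemma inj_on_singled_out: "inj_on (singled_out r) {1..r}"
proof (rule inj_onI)
  fix i j assume i: "i \<in> {1..r}" and eq: "singled_out r i = singled_out r j"
  show "i = j"
    using i fun_cong[OF eq, of i] by (cases "i = j") (simp_all add: singled_out_def)
qed

lemma card_Qbar: "card (Qbar r) = r"
  using card_image[OF inj_on_singled_out, of r] by (simp add: Qbar_eq)

section \<open>Winning probabilities and values of games\<close>

lemma prover_game_finite_strategies:
  assumes "prover_game r G"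
  shows "finite (strategies r G)"
  using assms unfolding strategies_def prover_game_def questions_def
  by (intro finite_PiE) auto

lemma prover_game_strategies_nonempty:
  assumes "prover_game r G"
  shows "strategies r G \<noteq> {}"
  using assms unfolding strategies_def prover_game_def
  by (auto simp: PiE_eq_empty_iff)

lemma winning_prob_eq_card:
  assumes "prover_game r G"
  shows "winning_prob r G \<sigma> =
    card {q \<in> question_tuples G. accepts G q (\<lambda>j\<in>{1..r}. \<sigma> j (q j))} / card (question_tuples G)"
  using assms
  by (simp add: winning_prob_def prover_game_def measure_pmf_of_set Int_def)

lemma winning_prob_le_game_value:
  assumes "prover_game r G" "\<sigma> \<in> strategies r G"
  shows "winning_prob r G \<sigma> \<le> game_value r G"
  using assms prover_game_finite_strategies unfolding game_value_def
  by (intro Max_ge) auto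

text \<open>Questions are uniform, so winning probabilities are multiples of 1 over the number of
  question tuples; failing on one tuple costs at least one such unit.\<close>

lemma game_value_le_of_no_perfect_strategy:
  assumes G: "prover_game r G"
    and no_perfect: "\<And>\<sigma>. \<sigma> \<in> strategies r G \<Longrightarrow>
      \<exists>q\<in>question_tuples G. \<not> accepts G q (\<lambda>j\<in>{1..r}. \<sigma> j (q j))"
  shows "game_value r G \<le> 1 - 1 / card (question_tuples G)"
proof -
  have fin: "finite (question_tuples G)" and ne: "question_tuples G \<noteq> {}"
    using G by (auto simp: prover_game_def)
  have pos: "card (question_tuples G) > 0"
    using fin ne by (simp add: card_gt_0_iff)
  have "winning_prob r G \<sigma> \<le> 1 - 1 / card (question_tuples G)" if \<sigma>: "\<sigma> \<in> strategies r G" for \<sigma>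
  proof -
    let ?W = "{q \<in> question_tuples G. accepts G q (\<lambda>j\<in>{1..r}. \<sigma> j (q j))}"
    have "?W \<subset> question_tuples G"
      using no_perfect[OF \<sigma>] by blast
    then have "card ?W < card (question_tuples G)"
      using fin by (rule psubset_card_mono[rotated])
    then have "real (card ?W) \<le> real (card (question_tuples G)) - 1"
      by linarith
    then have "card ?W / card (question_tuples G)
        \<le> (real (card (question_tuples G)) - 1) / card (question_tuples G)"
      by (rule divide_right_mono) simp
    then show ?thesis
      using pos by (simp add: winning_prob_eq_card[OF G] diff_divide_distrib)
  qed
  then show ?thesis
    using prover_game_finite_strategies[OF G] prover_game_strategies_nonempty[OF G]
    by (simp add: game_value_def)
qed

lemma prover_game_parallel_repetition:
  assumes "prover_game r G"
  shows "prover_game r (parallel_repetition r G n)"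
  using assms
  by (auto simp: prover_game_def parallel_repetition_def PiE_eq_empty_iff
      intro!: finite_imageI finite_PiE)

section \<open>The game built from a set of words\<close>

definition letter_positions :: "nat \<Rightarrow> (nat \<Rightarrow> nat) \<Rightarrow> nat \<Rightarrow> nat set" where
  "letter_positions n w j = {l \<in> {1..n}. w l = j}"

text \<open>For \<open>q = singled_out r j\<close> and a letter \<open>w i\<close> in
  \<open>{1..r}\<close>, the condition \<open>q (w i) = 1\<close> says \<open>w i = j\<close>. For
  \<open>w\<close> in \<open>words r n\<close> the claimed sets partition the positions, so
  inconsistent claims are rejected.\<close>

definition line_game :: "nat \<Rightarrow> nat \<Rightarrow> (nat \<Rightarrow> nat) set \<Rightarrow> (nat, nat set \<times> nat) game" where
  "line_game r n S =
    \<lparr> question_tuples = Qbar r,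
      answer_set = (\<lambda>j. Pow {1..n} \<times> {1..n}),
      accepts = (\<lambda>q a. \<exists>w\<in>S. \<exists>i\<in>{1..n}.
        (\<forall>j\<in>{1..r}. a j = (letter_positions n w j, i)) \<and> q (w i) = 1) \<rparr>"

lemma prover_game_line_game:
  assumes "r \<ge> 1" "n \<ge> 1"
  shows "prover_game r (line_game r n S)"
  using assms by (auto simp: prover_game_def line_game_def Qbar_eq singled_out_def)

lemma accepts_line_gameI:
  assumes "w \<in> S" "i \<in> {1..n}" "q (w i) = 1"
    and "\<And>j. j \<in> {1..r} \<Longrightarrow> a j = (letter_positions n w j, i)"
  shows "accepts (line_game r n S) q a"
  unfolding line_game_def game.simps using assms by blast

section \<open>Words, and the combinatorial line given by a perfect strategy\<close>

lemma words_letter: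
  assumes "w \<in> words r n" "i \<in> {1..n}"
  shows "w i \<in> {1..r}"
  using assms unfolding words_def by (rule PiE_mem)

lemma words_undefined:
  assumes "w \<in> words r n" "i \<notin> {1..n}"
  shows "w i = undefined"
  using assms unfolding words_def by (rule PiE_arb)

text \<open>Think of \<open>w j\<close> as the word announced when prover \<open>j\<close> is
  singled out, and of \<open>A k\<close> as the set that prover \<open>k\<close> claims when it is
  not. A position in some \<open>A k\<close> carries the letter \<open>k\<close> in every
  \<open>w j\<close>; at all other positions \<open>w j\<close> has the letter \<open>j\<close>, so
  these are the wildcards.\<close>

lemma contains_combinatorial_line_of_sections:
  assumes r: "r \<ge> 3"
    and S: "S \<subseteq> words r n"
    and w: "\<And>j. j \<in> {1..r} \<Longrightarrow> w j \<in> S"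
    and A: "\<And>j k. j \<in> {1..r} \<Longrightarrow> k \<in> {1..r} \<Longrightarrow> k \<noteq> j \<Longrightarrow> letter_positions n (w j) k = A k"
    and i: "i \<in> {1..n}" "\<And>j. j \<in> {1..r} \<Longrightarrow> w j i = j"
  shows "contains_combinatorial_line r n S"
proof -
  \<comment> \<open>Here \<open>r \<ge> 3\<close> enters: claims about two letters are compared
    inside the word of a third prover.\<close>
  have third: "\<exists>m\<in>{1..r}. m \<noteq> j \<and> m \<noteq> k" for j k
  proof -
    have "card {j, k} < card {1..r}"
      using r card_insert_le_m1[of 2 "{k}" j] by simp
    then have "\<not> {1..r} \<subseteq> {j, k}"
      using card_mono[of "{j, k}" "{1..r}"] by auto
    then show ?thesis by blast
  qed
  have letter: "w j l \<in> {1..r}" if "j \<in> {1..r}" "l \<in> {1..n}" for j l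
    using words_letter S w[OF that(1)] that(2) by blast
  have A_iff: "l \<in> A k \<longleftrightarrow> l \<in> {1..n} \<and> w j l = k"
    if "j \<in> {1..r}" "k \<in> {1..r}" "k \<noteq> j" for j k l
    using A[OF that] by (auto simp: letter_positions_def)
  \<comment> \<open>For different letters, a third word has both \<open>A k\<close> and
    \<open>A k'\<close> as letter sets, and a position carries only one letter.\<close>
  have A_unique: "k = k'" if "k \<in> {1..r}" "k' \<in> {1..r}" "l \<in> A k" "l \<in> A k'" for k k' l
    using third[of k k'] A_iff that by metis
  have wA: "w j l = k" if jk: "j \<in> {1..r}" "k \<in> {1..r}" and l: "l \<in> {1..n}" "l \<in> A k" for j k l
  proof (cases "k = j")
    case True
    \<comment> \<open>The set of the letter \<open>j\<close> in \<open>w j\<close> itself is not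
      given by \<open>A\<close>, so the argument is indirect: another letter at \<open>l\<close>
      would put \<open>l\<close> into two different sets \<open>A\<close>.\<close>
    show ?thesis
    proof (rule ccontr)
      assume "w j l \<noteq> k"
      then have "l \<in> A (w j l)"
        using A_iff[OF jk(1) letter[OF jk(1) l(1)]] True l by blast
      then show False
        using A_unique[OF jk(2) letter[OF jk(1) l(1)] l(2)] \<open>w j l \<noteq> k\<close> by simp
    qed
  qed (use A_iff that in blast)
  \<comment> \<open>By \<open>wA\<close> all words agree on the fixed positions, so
    \<open>w 1\<close> can represent them.\<close>
  define b where "b = (\<lambda>l\<in>{1..n}.
    if \<exists>k\<in>{1..r}. l \<in> A k then Some (w 1 l) else None)"
  have one: "1 \<in> {1..r}" using r by simp
  \<comment> \<open>A word \<open>w m\<close> with \<open>m\<close> other than \<open>k\<close> has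
    the letter \<open>m\<close> at \<open>i\<close>; hence \<open>i\<close> lies in no
    \<open>A k\<close> and is a wildcard.\<close>
  have "i \<notin> A k" if "k \<in> {1..r}" for k
    using third[of k k] A_iff i that by metis
  then have "b i = None"
    using i by (auto simp: b_def)
  moreover have "b \<in> {1..n} \<rightarrow>\<^sub>E insert None (Some ` {1..r})"
    using letter[OF one] by (auto simp: b_def)
  moreover have "b \<notin> {1..n} \<rightarrow>\<^sub>E Some ` {1..r}"
  proof
    assume "b \<in> {1..n} \<rightarrow>\<^sub>E Some ` {1..r}"
    from PiE_mem[OF this i(1)] show False
      using \<open>b i = None\<close> by auto
  qed
  ultimately have "b \<in> patterns r n"
    by (simp add: patterns_def)
  moreover have "fill_pattern n b j = w j" if j: "j \<in> {1..r}" for j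
  proof
    fix l
    show "fill_pattern n b j l = w j l"
    proof (cases "l \<in> {1..n}")
      case l: True
      show ?thesis
      proof (cases "\<exists>k\<in>{1..r}. l \<in> A k")
        case True
        then obtain k where "k \<in> {1..r}" "l \<in> A k" by blast
        then have "w 1 l = k" "w j l = k"
          using wA one j l by blast+
        then show ?thesis
          using True l by (simp add: fill_pattern_def b_def)
      next
        case False
        \<comment> \<open>Any other letter of \<open>w j\<close> at \<open>l\<close> would put
          \<open>l\<close> into the corresponding \<open>A\<close>.\<close>
        then have "w j l = j"
          using A_iff[OF j letter[OF j l]] letter[OF j l] l by blast
        then show ?thesis
          using False l by (simp add: fill_pattern_def b_def)
      qed
    next
      case False
      have "w j \<in> words r n"
        using S w[OF j] by blast
      then show ?thesis
        using words_undefined[OF _ False, of "w j"] False by (auto simp: fill_pattern_def)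
    qed
  qed
  then have "combinatorial_line r n b \<subseteq> S"
    using w by (auto simp: combinatorial_line_def)
  ultimately show ?thesis
    by (auto simp: contains_combinatorial_line_def)
qed

text \<open>Prover \<open>k\<close> sees 0 on every question except its own, so the one answer
  \<open>\<sigma> k 0\<close> serves all questions \<open>j\<close> other than \<open>k\<close>.
  This ties together the words accepted on different questions.\<close>

lemma line_game_perfect_strategy_imp_line:
  assumes r: "r \<ge> 3" and S: "S \<subseteq> words r n"
    and perfect: "\<And>q. q \<in> Qbar r \<Longrightarrow> accepts (line_game r n S) q (\<lambda>j\<in>{1..r}. \<sigma> j (q j))"
  shows "contains_combinatorial_line r n S"
proof -
  have "\<forall>j\<in>{1..r}. \<exists>w i. w \<in> S \<and> i \<in> {1..n} \<and> w i = j \<and>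
      (\<forall>k\<in>{1..r}. k \<noteq> j \<longrightarrow> \<sigma> k 0 = (letter_positions n w k, i))"
  proof
    fix j assume j: "j \<in> {1..r}"
    then have "singled_out r j \<in> Qbar r" by (simp add: Qbar_eq)
    then obtain w i where w: "w \<in> S" "i \<in> {1..n}" "singled_out r j (w i) = 1"
      and ans: "\<And>k. k \<in> {1..r} \<Longrightarrow> \<sigma> k (singled_out r j k) = (letter_positions n w k, i)"
      using perfect[of "singled_out r j"] by (auto simp: line_game_def)
    have "w i \<in> {1..r}"
      using words_letter w S by blast
    then have "w i = j"
      using w(3) by (cases "w i = j") (simp_all add: singled_out_def)
    moreover have "\<sigma> k 0 = (letter_positions n w k, i)" if "k \<in> {1..r}" "k \<noteq> j" for k
      using ans[OF that(1)] that by (simp add: singled_out_def)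
    ultimately show "\<exists>w i. w \<in> S \<and> i \<in> {1..n} \<and> w i = j \<and>
      (\<forall>k\<in>{1..r}. k \<noteq> j \<longrightarrow> \<sigma> k 0 = (letter_positions n w k, i))"
      using w by blast
  qed
  then obtain w p where w: "\<And>j. j \<in> {1..r} \<Longrightarrow> w j \<in> S"
    and p: "\<And>j. j \<in> {1..r} \<Longrightarrow> p j \<in> {1..n}" "\<And>j. j \<in> {1..r} \<Longrightarrow> w j (p j) = j"
    and ans: "\<And>j k. j \<in> {1..r} \<Longrightarrow> k \<in> {1..r} \<Longrightarrow> k \<noteq> j \<Longrightarrow>
      \<sigma> k 0 = (letter_positions n (w j) k, p j)"
    by metis
  \<comment> \<open>The questions \<open>j\<close> and 1 are linked by a prover \<open>k\<close>
    that sees 0 in both; its one answer fixes both positions.\<close>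
  have p_eq: "p j = p 1" if j: "j \<in> {1..r}" for j
  proof -
    have "\<exists>k\<in>{1..r}. k \<noteq> j \<and> k \<noteq> 1"
      using r by (intro bexI[of _ "if j = 2 then 3 else 2"]) auto
    then obtain k where k: "k \<in> {1..r}" "k \<noteq> j" "k \<noteq> 1" by blast
    have one: "1 \<in> {1..r}" using r by simp
    show ?thesis
      using ans[OF j k(1,2)] ans[OF one k(1,3)] by simp
  qed
  show ?thesis
  proof (rule contains_combinatorial_line_of_sections[OF r S w])
    show "letter_positions n (w j) k = fst (\<sigma> k 0)"
      if "j \<in> {1..r}" "k \<in> {1..r}" "k \<noteq> j" for j k
      using ans[OF that] by simp
    show "p 1 \<in> {1..n}"
      using p(1)[of 1] r by simp
    show "w j (p 1) = j" if "j \<in> {1..r}" for j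
      using p(2)[OF that] p_eq[OF that] by simp
  qed
qed

section \<open>The honest strategy in the repeated game\<close>

definition word_question :: "nat \<Rightarrow> nat \<Rightarrow> (nat \<Rightarrow> nat) \<Rightarrow> nat \<Rightarrow> nat \<Rightarrow> nat" where
  "word_question r n w = (\<lambda>j\<in>{1..r}. \<lambda>i\<in>{1..n}. singled_out r (w i) j)"

lemma word_question_in_repetition:
  assumes "w \<in> words r n"
  shows "word_question r n w \<in> question_tuples (parallel_repetition r (line_game r n S) n)"
proof -
  have "(\<lambda>i\<in>{1..n}. singled_out r (w i)) \<in> {1..n} \<rightarrow>\<^sub>E Qbar r"
    unfolding restrict_PiE_iff Qbar_eq using words_letter[OF assms] by blast
  then have "(\<lambda>j\<in>{1..r}. \<lambda>i\<in>{1..n}. (\<lambda>i\<in>{1..n}. singled_out r (w i)) i j)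
      \<in> question_tuples (parallel_repetition r (line_game r n S) n)"
    unfolding parallel_repetition_def line_game_def game.simps by (rule imageI)
  moreover have "word_question r n w =
      (\<lambda>j\<in>{1..r}. \<lambda>i\<in>{1..n}. (\<lambda>i\<in>{1..n}. singled_out r (w i)) i j)"
    by (auto simp: word_question_def fun_eq_iff)
  ultimately show ?thesis by simp
qed

text \<open>Wins will be counted by words. At prover \<open>v i\<close> and coordinate
  \<open>i\<close> the word \<open>v\<close> gives 1, while \<open>w\<close> gives 0 unless the
  letters agree.\<close>

lemma inj_on_word_question: "inj_on (word_question r n) (words r n)"
proof (rule inj_onI)
  fix v w assume v: "v \<in> words r n" and w: "w \<in> words r n"
    and eq: "word_question r n v = word_question r n w"
  show "v = w"
  proof
    fix i
    show "v i = w i"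
    proof (cases "i \<in> {1..n}")
      case True
      then have "v i \<in> {1..r}"
        using words_letter v by blast
      then show ?thesis
        using True fun_cong[OF fun_cong[OF eq, of "v i"], of i]
        by (cases "v i = w i") (simp_all add: word_question_def singled_out_def)
    qed (simp add: words_undefined[OF v] words_undefined[OF w])
  qed
qed

text \<open>An upper bound suffices: this number is the denominator of a winning probability to be
  bounded from below.\<close>

lemma card_question_tuples_parallel_repetition_le:
  assumes "finite (question_tuples G)"
  shows "card (question_tuples (parallel_repetition r G n)) \<le> card (question_tuples G) ^ n"
proof -
  have "card (question_tuples (parallel_repetition r G n))
      \<le> card ({1..n} \<rightarrow>\<^sub>E question_tuples G)"
    using assms by (auto simp: parallel_repetition_def intro!: card_image_le finite_PiE)
  then show ?thesis
    by (simp add: card_PiE)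
qed

lemma line_game_repetition_value_ge:
  assumes r: "r \<ge> 1" and n: "n \<ge> 1" and S: "S \<subseteq> words r n"
  shows "word_density r n S \<le> game_value r (parallel_repetition r (line_game r n S) n)"
proof -
  let ?Gn = "parallel_repetition r (line_game r n S) n"
  \<comment> \<open>Each prover reads off where its vector \<open>v\<close> is 1. On
    \<open>word_question r n w\<close> this yields the positions of its letter in \<open>w\<close>,
    so all copies announce the same word; copy \<open>i\<close> announces the position
    \<open>i\<close>.\<close>
  define \<sigma> where "\<sigma> = (\<lambda>j\<in>{1..r}. \<lambda>v\<in>questions ?Gn j. \<lambda>i\<in>{1..n}. (letter_positions n v 1, i))"
  have Gn: "prover_game r ?Gn"
    using prover_game_parallel_repetition[OF prover_game_line_game[OF r n]] .
  have \<sigma>: "\<sigma> \<in> strategies r ?Gn"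
    unfolding strategies_def \<sigma>_def
    by (auto simp: parallel_repetition_def line_game_def letter_positions_def)
  let ?W = "{x \<in> question_tuples ?Gn. accepts ?Gn x (\<lambda>j\<in>{1..r}. \<sigma> j (x j))}"
  have fin: "finite (question_tuples ?Gn)" and ne: "question_tuples ?Gn \<noteq> {}"
    using Gn by (auto simp: prover_game_def)
  have "word_question r n w \<in> ?W" if w: "w \<in> S" for w
  proof -
    have x: "word_question r n w \<in> question_tuples ?Gn"
      using word_question_in_repetition w S by blast
    have q: "word_question r n w j \<in> questions ?Gn j" for j
      using x by (auto simp: questions_def)
    have pos: "letter_positions n (word_question r n w j) 1 = letter_positions n w j"
      if "j \<in> {1..r}" for j
      using that by (auto simp: letter_positions_def word_question_def singled_out_def)
    have wr: "w i \<in> {1..r}" if "i \<in> {1..n}" for i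
      using words_letter w S that by blast
    have "accepts (line_game r n S) (\<lambda>j\<in>{1..r}. word_question r n w j i)
        (\<lambda>j\<in>{1..r}. (\<lambda>j\<in>{1..r}. \<sigma> j (word_question r n w j)) j i)" if i: "i \<in> {1..n}" for i
    proof -
      \<comment> \<open>Copy \<open>i\<close> singles out prover \<open>w i\<close>, so the letter
        at the announced position \<open>i\<close> is the right one.\<close>
      have "(\<lambda>j\<in>{1..r}. word_question r n w j i) (w i) = 1"
        using wr[OF i] i by (simp add: word_question_def singled_out_def)
      moreover have "\<sigma> j (word_question r n w j) i = (letter_positions n w j, i)"
        if "j \<in> {1..r}" for j
        using that i q[of j] pos[OF that] by (simp add: \<sigma>_def)
      ultimately show ?thesis
        by (intro accepts_line_gameI[OF w i]) simp_all
    qed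
    then show ?thesis
      using x by (simp add: parallel_repetition_def)
  qed
  then have "word_question r n ` S \<subseteq> ?W" by blast
  then have "card (word_question r n ` S) \<le> card ?W"
    using fin by (intro card_mono) auto
  then have "card S \<le> card ?W"
    using card_image[OF inj_on_subset[OF inj_on_word_question S]] by simp
  moreover have "card (question_tuples ?Gn) \<le> r ^ n"
    using card_question_tuples_parallel_repetition_le[of "line_game r n S" r n]
      prover_game_line_game[OF r n, of S]
    by (simp add: prover_game_def line_game_def card_Qbar)
  moreover have "card (question_tuples ?Gn) > 0"
    using fin ne by (simp add: card_gt_0_iff)
  ultimately have "word_density r n S \<le> winning_prob r ?Gn \<sigma>"
    unfolding word_density_def winning_prob_eq_card[OF Gn]
    by (intro frac_le) (simp_all del: of_nat_power)
  also have "\<dots> \<le> game_value r ?Gn"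
    using winning_prob_le_game_value[OF Gn \<sigma>] .
  finally show ?thesis .
qed

theorem theorem1p7:
  fixes r n :: nat and S :: "(nat \<Rightarrow> nat) set"
  assumes "r \<ge> 3" and "n \<ge> 1"
    and "S \<subseteq> words r n"
    and "\<not> contains_combinatorial_line r n S"
  shows "\<exists>G :: (nat, nat set \<times> nat) game.
           prover_game r G \<and>
           question_tuples G = Qbar r \<and>
           (\<forall>j\<in>{1..r}. answer_set G j = Pow {1..n} \<times> {1..n}) \<and>
           game_value r G \<le> 1 - 1 / real r \<and>
           game_value r (parallel_repetition r G n) \<ge> word_density r n S"
proof (intro exI conjI)
  let ?G = "line_game r n S"
  have r: "r \<ge> 1" using assms(1) by simp
  show G: "prover_game r ?G"
    using prover_game_line_game[OF r assms(2)] .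
  show Q: "question_tuples ?G = Qbar r"
    by (simp add: line_game_def)
  show "\<forall>j\<in>{1..r}. answer_set ?G j = Pow {1..n} \<times> {1..n}"
    by (simp add: line_game_def)
  \<comment> \<open>Winning on all questions would put a line into \<open>S\<close>, so at least one
    of the \<open>r\<close> equally likely questions is lost.\<close>
  have "\<exists>q\<in>Qbar r. \<not> accepts ?G q (\<lambda>j\<in>{1..r}. \<sigma> j (q j))" for \<sigma>
    using line_game_perfect_strategy_imp_line[OF assms(1,3)] assms(4) by blast
  then show "game_value r ?G \<le> 1 - 1 / real r"
    using game_value_le_of_no_perfect_strategy[OF G] by (simp add: Q card_Qbar)
  show "game_value r (parallel_repetition r ?G n) \<ge> word_density r n S"
    using line_game_repetition_value_ge[OF r assms(2,3)] .
qed

end
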